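(* For any $n\ge 1$ there are only finitely many types of quasi smooth hypersurfaces with trivial canonical class in weighted projective spaces $\mathbb{P}(a_0,\dots,a_n)$. That is, there are only finitely many $(n+1)$-tuples of positive integers $(a_0,\dots,a_n)$, any $n$ of which are relatively prime, such that $\mathbb{P}(a_0,\dots,a_n)$ contains a quasi smooth hypersurface of degree $d=a_0+\cdots+a_n$.
   Context: Work over $\mathbb{C}$. $\mathbb{P}(a_0,\dots,a_n)$ is the weighted projective $n$-space with coordinates $x_0,\dots,x_n$, $\deg x_i=a_i$. A hypersurface of degree $d$ is the zero set $(F=0)$ of a nonzero weighted homogeneous polynomial of weighted degree $d$. It is quasi smooth if it is smooth in the orbifold sense, i.e. the affine cone $(F=0)\subset\mathbb{C}^{n+1}$ is smooth away from the origin. The canonical class is computed by the adjunction formula $K_X\cong\mathcal{O}_{\mathbb{P}}(d-(a_0+\cdots+a_n))|_X$ (valid if $X$ contains no codimension $2$ singular subset of $\mathbb{P}$), so trivial canonical class means $d=a_0+\cdots+a_n$. The type of a hypersurface is given by the weights and the degree. *)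

theory Defs
  imports Complex_Main "HOL-Library.Poly_Mapping"
begin

text \<open>
  Complex polynomials in the variables \<open>x\<^sub>0, x\<^sub>1, \<dots>\<close>: finitely supported maps from exponent
  vectors (themselves finitely supported) to coefficients.
\<close>

type_synonym cpoly = "(nat \<Rightarrow>\<^sub>0 nat) \<Rightarrow>\<^sub>0 complex"

definition poly_eval :: "cpoly \<Rightarrow> (nat \<Rightarrow> complex) \<Rightarrow> complex" where
  "poly_eval F z =
     (\<Sum>m\<in>Poly_Mapping.keys F.
        Poly_Mapping.lookup F m *
        (\<Prod>i\<in>Poly_Mapping.keys m. z i ^ Poly_Mapping.lookup m i))"

text \<open>
  Formal partial derivative. The subtraction of exponent vectors is truncated, which is harmless:
  if \<open>x\<^sub>i\<close> does not occur in the monomial, then the coefficient is \<open>0\<close>.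
\<close>

definition partial_deriv :: "nat \<Rightarrow> cpoly \<Rightarrow> cpoly" where
  "partial_deriv i F =
     (\<Sum>m\<in>Poly_Mapping.keys F.
        Poly_Mapping.single (m - Poly_Mapping.single i 1)
          (of_nat (Poly_Mapping.lookup m i) * Poly_Mapping.lookup F m))"

text \<open>
  A list \<open>a\<close> of weights stands for the weighted projective space with coordinates
  \<open>x\<^sub>i\<close> (\<open>i < length a\<close>) of degree \<open>a ! i\<close>.
\<close>

definition weighted_homogeneous :: "nat list \<Rightarrow> nat \<Rightarrow> cpoly \<Rightarrow> bool" where
  "weighted_homogeneous a d F \<longleftrightarrow>
     (\<forall>m\<in>Poly_Mapping.keys F.
        Poly_Mapping.keys m \<subseteq> {..<length a} \<and>
        (\<Sum>i<length a. a ! i * Poly_Mapping.lookup m i) = d)"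

text \<open>
  Smoothness of the affine cone \<open>(F = 0)\<close> away from the origin is smoothness of the scheme defined
  by \<open>F\<close>, given by the Jacobian criterion. In particular, a cone along which \<open>F\<close> vanishes to order
  at least two is not smooth, even if the underlying zero set is. Only the coordinates \<open>z i\<close> with
  \<open>i < length a\<close> matter.
\<close>

definition cone_smooth_away_from_origin :: "nat list \<Rightarrow> cpoly \<Rightarrow> bool" where
  "cone_smooth_away_from_origin a F \<longleftrightarrow>
     (\<forall>z. (\<exists>i<length a. z i \<noteq> 0) \<and> poly_eval F z = 0 \<longrightarrow>
        (\<exists>i<length a. poly_eval (partial_deriv i F) z \<noteq> 0))"

definition quasi_smooth_hypersurface :: "nat list \<Rightarrow> nat \<Rightarrow> cpoly \<Rightarrow> bool" where
  "quasi_smooth_hypersurface a d F \<longleftrightarrow>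
     F \<noteq> 0 \<and> weighted_homogeneous a d F \<and> cone_smooth_away_from_origin a F"

text \<open>
  Any \<open>length a - 1\<close> of the weights have greatest common divisor \<open>1\<close>; this is not pairwise
  coprimality.
\<close>

definition well_formed_weights :: "nat list \<Rightarrow> bool" where
  "well_formed_weights a \<longleftrightarrow>
     (\<forall>i<length a. Gcd {a ! j | j. j < length a \<and> j \<noteq> i} = 1)"

end

theory Submission
  imports Defs "HOL-Library.Function_Algebras" "HOL-Computational_Algebra.Fundamental_Theorem_Algebra"
begin

text \<open>
  Since the weights have no common factor, \<open>a\<close> is determined by \<open>q = a / d\<close>, a point with coordinate
  sum \<open>1\<close>. If \<open>p \<noteq> q\<close> is another positive point with coordinate sum \<open>1\<close>, then quasi-smoothness forces
  a monomial \<open>m\<close> of \<open>F\<close> (so \<open>q \<bullet> m = 1\<close>) with \<open>p \<bullet> m < 1\<close>. For fixed \<open>p\<close> there are only finitely many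
  such \<open>m\<close>, so all normalized weights except \<open>p\<close> lie on finitely many hyperplanes missing \<open>p\<close>.
  Taking \<open>p\<close> itself among the normalized weights, the dimension of their span drops and induction
  applies; this is Skarke's finiteness argument for weight systems with the interior point property.
\<close>

section \<open>Evaluation and formal derivatives of polynomials\<close>

abbreviation monomial_eval :: "(nat \<Rightarrow>\<^sub>0 nat) \<Rightarrow> (nat \<Rightarrow> complex) \<Rightarrow> complex" where
  "monomial_eval m z \<equiv> (\<Prod>i\<in>Poly_Mapping.keys m. z i ^ Poly_Mapping.lookup m i)"

lemma poly_eval_superset:
  assumes "finite M" "Poly_Mapping.keys F \<subseteq> M"
  shows "poly_eval F z = (\<Sum>m\<in>M. Poly_Mapping.lookup F m * monomial_eval m z)"
  unfolding poly_eval_def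
  by (rule sum.mono_neutral_left) (use assms in \<open>auto simp: in_keys_iff\<close>)

lemma poly_eval_zero [simp]: "poly_eval 0 z = 0"
  by (simp add: poly_eval_def)

lemma poly_eval_add: "poly_eval (F + G) z = poly_eval F z + poly_eval G z"
proof -
  let ?M = "Poly_Mapping.keys F \<union> Poly_Mapping.keys G"
  have "poly_eval H z = (\<Sum>m\<in>?M. Poly_Mapping.lookup H m * monomial_eval m z)"
    if "Poly_Mapping.keys H \<subseteq> ?M" for H
    using that by (intro poly_eval_superset) auto
  then show ?thesis
    by (simp add: Poly_Mapping.keys_add lookup_add distrib_right sum.distrib)
qed

lemma poly_eval_sum: "poly_eval (sum f A) z = (\<Sum>x\<in>A. poly_eval (f x) z)"
  by (induction A rule: infinite_finite_induct) (auto simp: poly_eval_add)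

lemma poly_eval_single: "poly_eval (Poly_Mapping.single m c) z = c * monomial_eval m z"
  by (subst poly_eval_superset[of "{m}"]) auto

lemma poly_eval_partial_deriv:
  "poly_eval (partial_deriv i F) z =
     (\<Sum>m\<in>Poly_Mapping.keys F. of_nat (Poly_Mapping.lookup m i) * Poly_Mapping.lookup F m *
        monomial_eval (m - Poly_Mapping.single i 1) z)"
  by (simp add: partial_deriv_def poly_eval_sum poly_eval_single)

lemma keys_partial_derivE:
  assumes "m \<in> Poly_Mapping.keys (partial_deriv i F)"
  obtains m' where "m' \<in> Poly_Mapping.keys F" "Poly_Mapping.lookup m' i > 0"
    "m = m' - Poly_Mapping.single i 1"
proof -
  let ?f = "\<lambda>m'. Poly_Mapping.single (m' - Poly_Mapping.single i 1)
          (of_nat (Poly_Mapping.lookup m' i) * Poly_Mapping.lookup F m')"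
  have "Poly_Mapping.keys (partial_deriv i F) \<subseteq> (\<Union>m'\<in>Poly_Mapping.keys F. Poly_Mapping.keys (?f m'))"
    unfolding partial_deriv_def by (rule Poly_Mapping.keys_sum)
  with assms obtain m' where m': "m' \<in> Poly_Mapping.keys F" "m \<in> Poly_Mapping.keys (?f m')"
    by auto
  show thesis
  proof (rule that)
    show "m' \<in> Poly_Mapping.keys F" by (fact m')
    show "Poly_Mapping.lookup m' i > 0" using m'(2) by (auto intro: gr0I)
    show "m = m' - Poly_Mapping.single i 1" using m'(2) by (simp split: if_splits)
  qed
qed

text \<open>Positivity of the exponent makes the truncated subtraction genuine. The weights lie in a
  ring so that the identity serves both integral and real weights.\<close>

lemma sum_lookup_minus_single:
  fixes w :: "nat \<Rightarrow> 'a::comm_ring_1"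
  assumes "i < N" "Poly_Mapping.lookup m i > 0"
  shows "(\<Sum>j<N. w j * of_nat (Poly_Mapping.lookup m j)) =
         (\<Sum>j<N. w j * of_nat (Poly_Mapping.lookup (m - Poly_Mapping.single i 1) j)) + w i"
proof -
  have "w j * of_nat (Poly_Mapping.lookup m j) =
        w j * of_nat (Poly_Mapping.lookup (m - Poly_Mapping.single i 1) j) + (if j = i then w i else 0)" for j
    using assms(2)
    by (cases "Poly_Mapping.lookup m i")
       (auto simp: lookup_minus lookup_single when_def algebra_simps)
  then show ?thesis
    using assms(1) by (simp add: sum.distrib)
qed

lemma weighted_homogeneous_partial_deriv:
  assumes "weighted_homogeneous a d F" "i < length a"
  shows "weighted_homogeneous a (d - a ! i) (partial_deriv i F)"
  unfolding weighted_homogeneous_def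
proof (intro ballI conjI)
  fix m assume "m \<in> Poly_Mapping.keys (partial_deriv i F)"
  then obtain m' where m': "m' \<in> Poly_Mapping.keys F" "Poly_Mapping.lookup m' i > 0"
    "m = m' - Poly_Mapping.single i 1"
    by (rule keys_partial_derivE)
  show "Poly_Mapping.keys m \<subseteq> {..<length a}"
  proof
    fix j assume "j \<in> Poly_Mapping.keys m"
    then have "j \<in> Poly_Mapping.keys m'"
      using m'(3) by (auto simp: in_keys_iff lookup_minus)
    then show "j \<in> {..<length a}"
      using assms(1) m'(1) by (auto simp: weighted_homogeneous_def)
  qed
  have "(\<Sum>j<length a. int (a ! j) * of_nat (Poly_Mapping.lookup m' j)) =
        (\<Sum>j<length a. int (a ! j) * of_nat (Poly_Mapping.lookup m j)) + int (a ! i)"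
    unfolding m'(3) using assms(2) m'(2) by (rule sum_lookup_minus_single)
  then have "int (\<Sum>j<length a. a ! j * Poly_Mapping.lookup m' j) =
      int ((\<Sum>j<length a. a ! j * Poly_Mapping.lookup m j) + a ! i)"
    unfolding of_nat_add of_nat_sum of_nat_mult .
  moreover have "(\<Sum>j<length a. a ! j * Poly_Mapping.lookup m' j) = d"
    using assms(1) m'(1) by (simp add: weighted_homogeneous_def)
  ultimately show "(\<Sum>j<length a. a ! j * Poly_Mapping.lookup m j) = d - a ! i"
    by linarith
qed

lemma monomial_eval_eq_0:
  assumes "z i = 0" "Poly_Mapping.lookup m i \<noteq> 0"
  shows "monomial_eval m z = 0"
  by (rule prod_zero) (use assms in \<open>auto simp: in_keys_iff intro!: bexI[of _ i]\<close>)

section \<open>Zeros on a coordinate plane\<close>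

text \<open>If no monomial of \<open>G\<close> is a pure power of \<open>x_k\<close>, the coordinate
  point of \<open>x_k\<close> is a zero. Otherwise setting \<open>x_j = 1\<close> on the plane
  leaves a nonconstant polynomial in \<open>x_k\<close>, which has a complex root.\<close>

lemma weighted_homogeneous_zero_on_plane:
  assumes hom: "weighted_homogeneous a D G" and "D > 0"
    and jk: "j \<noteq> k" "j < length a" "k < length a" and pos: "a ! j > 0"
  shows "\<exists>z. (\<forall>i. i \<noteq> j \<and> i \<noteq> k \<longrightarrow> z i = 0) \<and> (z j \<noteq> 0 \<or> z k \<noteq> 0) \<and> poly_eval G z = 0"
proof (cases "\<exists>m\<in>Poly_Mapping.keys G. \<forall>i. i \<noteq> k \<longrightarrow> Poly_Mapping.lookup m i = 0")
  case False
  let ?z = "(\<lambda>i. if i = k then 1 else 0) :: nat \<Rightarrow> complex"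
  have "poly_eval G ?z = 0"
    unfolding poly_eval_def
  proof (intro sum.neutral ballI)
    fix m assume "m \<in> Poly_Mapping.keys G"
    then obtain i where "i \<noteq> k" "Poly_Mapping.lookup m i \<noteq> 0"
      using False by blast
    then have "monomial_eval m ?z = 0"
      by (intro monomial_eval_eq_0) auto
    then show "Poly_Mapping.lookup G m * monomial_eval m ?z = 0"
      by (simp only: mult_zero_right)
  qed
  then show ?thesis
    by (intro exI[of _ ?z]) auto
next
  case True
  then obtain m0 where m0: "m0 \<in> Poly_Mapping.keys G" "\<And>i. i \<noteq> k \<Longrightarrow> Poly_Mapping.lookup m0 i = 0"
    by blast
  define z where "z t i = (if i = j then 1 else if i = k then t else 0 :: complex)" for t i
  \<comment> \<open>\<open>K\<close> collects the monomials that survive on the plane;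
    \<open>P\<close> is the restriction of \<open>G\<close> to the line \<open>x_j = 1\<close> in
    it.\<close>
  define K where "K = {m\<in>Poly_Mapping.keys G. \<forall>i. i \<noteq> j \<and> i \<noteq> k \<longrightarrow> Poly_Mapping.lookup m i = 0}"
  define P where "P = (\<Sum>m\<in>K. monom (Poly_Mapping.lookup G m) (Poly_Mapping.lookup m k))"
  have deg: "a ! j * Poly_Mapping.lookup m j + a ! k * Poly_Mapping.lookup m k = D" if "m \<in> K" for m
  proof -
    have "D = (\<Sum>i<length a. a ! i * Poly_Mapping.lookup m i)"
      using hom that by (simp add: weighted_homogeneous_def K_def)
    also have "\<dots> = (\<Sum>i\<in>{j,k}. a ! i * Poly_Mapping.lookup m i)"
      by (rule sum.mono_neutral_right) (use that jk in \<open>auto simp: K_def\<close>)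
    finally show ?thesis using jk by simp
  qed
  have "m0 \<in> K" using m0 by (simp add: K_def)
  have finK: "finite K" by (simp add: K_def)
  \<comment> \<open>\<open>D > 0\<close> excludes the constant monomial, so the pure power has
    positive exponent.\<close>
  have mk: "Poly_Mapping.lookup m0 k > 0"
    using deg[OF \<open>m0 \<in> K\<close>] m0(2)[of j] jk \<open>D > 0\<close> by (cases "Poly_Mapping.lookup m0 k") auto
  \<comment> \<open>Homogeneity and \<open>a ! j > 0\<close> recover the exponent of
    \<open>x_j\<close> from that of \<open>x_k\<close>, so no other monomial of \<open>K\<close>
    contributes to the coefficient of \<open>P\<close> at the exponent of \<open>m0\<close>.\<close>
  have only: "m = m0" if "m \<in> K" "Poly_Mapping.lookup m k = Poly_Mapping.lookup m0 k" for m
  proof (rule poly_mapping_eqI)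
    fix i
    have "Poly_Mapping.lookup m j = 0"
      using deg[OF that(1)] deg[OF \<open>m0 \<in> K\<close>] that(2) m0(2)[of j] jk pos by auto
    then show "Poly_Mapping.lookup m i = Poly_Mapping.lookup m0 i"
      using that m0(2) by (cases "i = j"; cases "i = k") (auto simp: K_def)
  qed
  have "coeff P (Poly_Mapping.lookup m0 k) =
        (\<Sum>m\<in>K. if m = m0 then Poly_Mapping.lookup G m0 else 0)"
    unfolding P_def coeff_sum by (intro sum.cong) (auto dest: only)
  then have "coeff P (Poly_Mapping.lookup m0 k) \<noteq> 0"
    using \<open>m0 \<in> K\<close> finK m0(1) by (simp add: in_keys_iff)
  then have "degree P > 0"
    using mk le_degree[of P] by fastforce
  then have "\<not> constant (poly P)"
    by (simp add: constant_degree)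
  then obtain t where t: "poly P t = 0"
    using fundamental_theorem_of_algebra by blast
  have "poly_eval G (z t) = (\<Sum>m\<in>K. Poly_Mapping.lookup G m * monomial_eval m (z t))"
    unfolding poly_eval_def
  proof (rule sum.mono_neutral_right)
    show "\<forall>m\<in>Poly_Mapping.keys G - K. Poly_Mapping.lookup G m * monomial_eval m (z t) = 0"
    proof
      fix m assume "m \<in> Poly_Mapping.keys G - K"
      then obtain i where "i \<noteq> j" "i \<noteq> k" "Poly_Mapping.lookup m i \<noteq> 0"
        by (auto simp: K_def)
      then have "monomial_eval m (z t) = 0"
        by (intro monomial_eval_eq_0) (auto simp: z_def)
      then show "Poly_Mapping.lookup G m * monomial_eval m (z t) = 0"
        by (simp only: mult_zero_right)
    qed
  qed (auto simp: K_def)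
  also have "\<dots> = poly P t"
    unfolding P_def poly_sum poly_monom
  proof (rule sum.cong[OF refl])
    fix m assume "m \<in> K"
    have "monomial_eval m (z t) = (\<Prod>i\<in>{j,k}. z t i ^ Poly_Mapping.lookup m i)"
      by (rule prod.mono_neutral_left) (use \<open>m \<in> K\<close> in \<open>auto simp: K_def in_keys_iff\<close>)
    also have "\<dots> = t ^ Poly_Mapping.lookup m k"
      using jk by (simp add: z_def)
    finally show "Poly_Mapping.lookup G m * monomial_eval m (z t) =
        Poly_Mapping.lookup G m * t ^ Poly_Mapping.lookup m k" by simp
  qed
  finally have "poly_eval G (z t) = 0" using t by simp
  then show ?thesis
    by (intro exI[of _ "z t"]) (auto simp: z_def)
qed

section \<open>Separation of weights by a monomial\<close>

text \<open>Equal sums and \<open>p \<noteq> q\<close> force some coordinate to decrease along the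
  ray from \<open>q\<close> through \<open>p\<close>. Such a coordinate reaches zero at time
  \<open>q i / (q i - p i)\<close>; the least of these times is the exit time
  \<open>T\<close>.\<close>

lemma simplex_ray_exit:
  fixes p q :: "nat \<Rightarrow> real"
  assumes q: "\<And>i. i < N \<Longrightarrow> q i > 0" and sums: "(\<Sum>i<N. q i) = (\<Sum>i<N. p i)"
    and ne: "\<exists>i<N. p i \<noteq> q i"
  obtains T where "T \<ge> 0" "\<And>i. i < N \<Longrightarrow> q i + T * (p i - q i) \<ge> 0"
    "\<exists>i<N. q i + T * (p i - q i) = 0"
proof -
  define I where "I = {i. i < N \<and> p i < q i}"
  have "I \<noteq> {}"
  proof
    assume "I = {}"
    then have "\<And>i. i < N \<Longrightarrow> p i - q i \<ge> 0" by (force simp: I_def)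
    moreover have "(\<Sum>i<N. p i - q i) = 0"
      using sums by (simp add: sum_subtractf)
    ultimately have "\<forall>i\<in>{..<N}. p i - q i = 0"
      by (subst (asm) sum_nonneg_eq_0_iff) auto
    then show False using ne by auto
  qed
  have "finite I" by (simp add: I_def)
  define T where "T = Min ((\<lambda>i. q i / (q i - p i)) ` I)"
  have "T \<in> (\<lambda>i. q i / (q i - p i)) ` I"
    unfolding T_def using \<open>I \<noteq> {}\<close> \<open>finite I\<close> by (intro Min_in) auto
  then obtain k where k: "k \<in> I" "T = q k / (q k - p k)" by blast
  show thesis
  proof
    show "T \<ge> 0" using k q[of k] by (simp add: I_def)
    show "\<exists>i<N. q i + T * (p i - q i) = 0"
      using k by (intro exI[of _ k]) (simp add: I_def field_simps)
    show "q i + T * (p i - q i) \<ge> 0" if "i < N" for i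
    proof (cases "i \<in> I")
      case True
      then have "T \<le> q i / (q i - p i)"
        unfolding T_def using \<open>finite I\<close> by (intro Min_le) auto
      then have "T * (q i - p i) \<le> q i"
        using True by (simp add: I_def pos_le_divide_eq)
      then show ?thesis by (simp add: algebra_simps)
    next
      case False
      then have "T * (p i - q i) \<ge> 0" using \<open>T \<ge> 0\<close> that by (simp add: I_def)
      then show ?thesis using q[OF that] by linarith
    qed
  qed
qed

text \<open>
  Moving from \<open>q = a / d\<close> in the direction \<open>p - q\<close> until a weight vanishes gives weights \<open>r\<close>
  for which every monomial of \<open>F\<close> still has weight at least \<open>1\<close>. Hence \<open>F\<close> vanishes on the coordinate
  subspace of the vanishing weights, and along it only a partial derivative in a direction of weight
  \<open>1\<close> can be nonzero. There is at most one such direction, and then the subspace is a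
  coordinate hyperplane, on which that derivative has a nontrivial zero.
\<close>

lemma quasi_smooth_separating_monomial:
  fixes p :: "nat \<Rightarrow> real"
  assumes qs: "quasi_smooth_hypersurface a d F"
    and len: "length a \<ge> 3" and a_pos: "\<And>i. i < length a \<Longrightarrow> a ! i > 0"
    and d: "d = (\<Sum>i<length a. a ! i)"
    and p_sum: "(\<Sum>i<length a. p i) = 1"
    and ne: "\<exists>i<length a. p i \<noteq> real (a ! i) / real d"
  shows "\<exists>m\<in>Poly_Mapping.keys F. (\<Sum>i<length a. p i * real (Poly_Mapping.lookup m i)) < 1"
proof (rule ccontr)
  assume "\<not> ?thesis"
  then have p_ge: "(\<Sum>i<length a. p i * real (Poly_Mapping.lookup m i)) \<ge> 1"
    if "m \<in> Poly_Mapping.keys F" for m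
    using that by (meson not_le)
  let ?N = "length a"
  define q where "q i = real (a ! i) / real d" for i
  have hom: "weighted_homogeneous a d F" and smooth: "cone_smooth_away_from_origin a F"
    using qs by (auto simp: quasi_smooth_hypersurface_def)
  \<comment> \<open>A second positive weight makes this strict; later it makes the degree
    \<open>d - a ! i\<close> of a partial derivative positive.\<close>
  have lt_d: "a ! i < d" if "i < ?N" for i
  proof -
    define j where "j = (if i = 0 then 1 else 0 :: nat)"
    have j: "j < ?N" "j \<noteq> i" using len by (auto simp: j_def)
    have "(\<Sum>k\<in>{i,j}. a ! k) \<le> d"
      unfolding d using that j by (intro sum_mono2) auto
    then show ?thesis using j a_pos[of j] by auto
  qed
  have "0 < ?N" using len by linarith
  then have d_pos: "d > 0" using lt_d by fastforce
  have q_pos: "q i > 0" if "i < ?N" for i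
    using a_pos[OF that] d_pos by (simp add: q_def)
  have q_sum: "(\<Sum>i<?N. q i) = 1"
  proof -
    have "(\<Sum>i<?N. q i) = real (\<Sum>i<?N. a ! i) / real d"
      by (simp only: q_def of_nat_sum sum_divide_distrib)
    then show ?thesis using d_pos by (simp only: flip: d) simp
  qed
  have q_eq: "(\<Sum>i<?N. q i * real (Poly_Mapping.lookup m i)) = 1" if "m \<in> Poly_Mapping.keys F" for m
  proof -
    have "(\<Sum>i<?N. a ! i * Poly_Mapping.lookup m i) = d"
      using hom that by (simp add: weighted_homogeneous_def)
    then have "(\<Sum>i<?N. real (a ! i) * real (Poly_Mapping.lookup m i)) = real d"
      by (metis (mono_tags, lifting) of_nat_mult of_nat_sum sum.cong)
    then show ?thesis
      using d_pos by (simp add: q_def flip: sum_divide_distrib)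
  qed
  obtain T where T: "T \<ge> 0" "\<And>i. i < ?N \<Longrightarrow> q i + T * (p i - q i) \<ge> 0"
    "\<exists>i<?N. q i + T * (p i - q i) = 0"
    using simplex_ray_exit[of ?N q p] q_pos q_sum p_sum ne by (auto simp: q_def)
  define r where "r i = q i + T * (p i - q i)" for i
  have r_nonneg: "r i \<ge> 0" if "i < ?N" for i using T(2)[OF that] by (simp add: r_def)
  have r_sum: "(\<Sum>i<?N. r i) = 1"
    by (simp add: r_def sum.distrib sum_subtractf q_sum p_sum flip: sum_distrib_left)
  \<comment> \<open>By linearity the new weight of \<open>m\<close> is
    \<open>1 + T * (w - 1)\<close>, where \<open>w \<ge> 1\<close> is its weight for
    \<open>p\<close>.\<close>
  have r_ge: "(\<Sum>i<?N. r i * real (Poly_Mapping.lookup m i)) \<ge> 1" if "m \<in> Poly_Mapping.keys F" for m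
  proof -
    let ?m = "\<lambda>i. real (Poly_Mapping.lookup m i)"
    have "(\<Sum>i<?N. r i * ?m i) =
        (\<Sum>i<?N. q i * ?m i) + T * ((\<Sum>i<?N. p i * ?m i) - (\<Sum>i<?N. q i * ?m i))"
      by (simp add: r_def algebra_simps sum.distrib sum_subtractf sum_distrib_left)
    then show ?thesis
      using q_eq[OF that] p_ge[OF that] T(1) by simp
  qed
  \<comment> \<open>A monomial that is nonzero at \<open>z\<close> uses only variables with
    \<open>z i \<noteq> 0\<close>, and those have weight 0.\<close>
  have r_zero: "(\<Sum>i<?N. r i * real (Poly_Mapping.lookup m i)) = 0"
    if "monomial_eval m z \<noteq> 0" "\<And>i. i < ?N \<Longrightarrow> r i \<noteq> 0 \<Longrightarrow> z i = 0" for m z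
  proof (intro sum.neutral ballI)
    fix i assume "i \<in> {..<?N}"
    then show "r i * real (Poly_Mapping.lookup m i) = 0"
      using that(1) monomial_eval_eq_0[of z i m] that(2)[of i] by fastforce
  qed
  have weight1: "\<exists>i<?N. r i \<ge> 1 \<and> poly_eval (partial_deriv i F) z \<noteq> 0"
    if nz: "\<exists>i<?N. z i \<noteq> 0" and z: "\<And>i. i < ?N \<Longrightarrow> r i \<noteq> 0 \<Longrightarrow> z i = 0" for z
  proof -
    have "poly_eval F z = 0"
      unfolding poly_eval_def
    proof (intro sum.neutral ballI)
      fix m assume "m \<in> Poly_Mapping.keys F"
      then have "monomial_eval m z = 0"
        using r_ge[of m] r_zero[of z m] z by fastforce
      then show "Poly_Mapping.lookup F m * monomial_eval m z = 0"
        by (simp only: mult_zero_right)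
    qed
    then obtain i where i: "i < ?N" "poly_eval (partial_deriv i F) z \<noteq> 0"
      using smooth nz by (auto simp: cone_smooth_away_from_origin_def)
    then obtain m where m: "m \<in> Poly_Mapping.keys F" "Poly_Mapping.lookup m i > 0"
      "monomial_eval (m - Poly_Mapping.single i 1) z \<noteq> 0"
      unfolding poly_eval_partial_deriv
      by (smt (verit, ccfv_threshold) gr0I mult_eq_0_iff of_nat_0 sum.neutral)
    \<comment> \<open>After one factor \<open>x_i\<close> is removed, \<open>m\<close> consists of
      variables of weight 0, so its whole weight is \<open>r i\<close>.\<close>
    have "r i = (\<Sum>j<?N. r j * real (Poly_Mapping.lookup m j))"
      using sum_lookup_minus_single[OF i(1) m(2), of r] r_zero[OF m(3)] z by simp
    then show ?thesis using r_ge[OF m(1)] i by auto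
  qed
  obtain k where k: "k < ?N" "r k = 0" using T(3) by (auto simp: r_def)
  \<comment> \<open>The coordinate point of a variable of weight 0 produces the direction
    \<open>i\<close>.\<close>
  obtain i where i: "i < ?N" "r i \<ge> 1"
    using weight1[of "\<lambda>j. if j = k then 1 else 0"] k by fastforce
  have r_other: "r j = 0" if "j < ?N" "j \<noteq> i" for j
  proof -
    have "(\<Sum>l\<in>{i,j}. r l) \<le> (\<Sum>l<?N. r l)"
      using that i r_nonneg by (intro sum_mono2) auto
    then show ?thesis using that i r_sum r_nonneg[of j] by auto
  qed
  \<comment> \<open>\<open>j\<close> and \<open>l\<close> are two distinct indices other than
    \<open>i\<close>, available because there are at least three weights.\<close>
  define j where "j = (if i = 0 then 1 else 0 :: nat)"
  define l where "l = (if i \<le> 1 then 2 else 1 :: nat)"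
  have jl: "j \<noteq> l" "j < ?N" "l < ?N" "i \<noteq> j" "i \<noteq> l"
    using len by (auto simp: j_def l_def)
  obtain z where z: "\<And>k. k \<noteq> j \<Longrightarrow> k \<noteq> l \<Longrightarrow> z k = 0" "z j \<noteq> 0 \<or> z l \<noteq> 0"
    "poly_eval (partial_deriv i F) z = 0"
    using weighted_homogeneous_zero_on_plane[OF weighted_homogeneous_partial_deriv[OF hom i(1)] _ jl(1-3)]
      lt_d[OF i(1)] a_pos[OF jl(2)] by auto
  \<comment> \<open>All weights but that of \<open>i\<close> vanish, so the direction found here can
    only be \<open>i\<close>, whose derivative is zero at \<open>z\<close>.\<close>
  obtain i' where "i' < ?N" "r i' \<ge> 1" "poly_eval (partial_deriv i' F) z \<noteq> 0"
    using weight1[of z] z(1,2) jl r_other by metis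
  then show False using r_other[of i'] z(3) by fastforce
qed

section \<open>Finiteness by induction on the dimension of the span\<close>

text \<open>
  The sets \<open>S \<inter> V\<close> with \<open>V\<close> in the family for \<open>p\<close> span a subspace of smaller dimension, since
  they omit \<open>p\<close>.
\<close>

lemma (in vector_space) finite_if_covered_by_avoiding_subspaces:
  assumes "finite B" "S \<subseteq> span B"
    and "\<And>p. p \<in> S \<Longrightarrow> \<exists>H. finite H \<and> (\<forall>V\<in>H. subspace V \<and> p \<notin> V) \<and> S - {p} \<subseteq> \<Union>H"
  shows "finite S"
  using assms
proof (induction "card B" arbitrary: B S rule: less_induct)
  case less
  show ?case
  proof (cases "S = {}")
    case False
    then obtain p where p: "p \<in> S" by blast
    then obtain H where H: "finite H" "\<forall>V\<in>H. subspace V \<and> p \<notin> V" "S - {p} \<subseteq> \<Union>H"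
      using less.prems(3)[OF p] by auto
    have "finite (S \<inter> V)" if V: "V \<in> H" for V
    proof -
      obtain C where C: "C \<subseteq> S \<inter> V" "independent C" "S \<inter> V \<subseteq> span C"
        using maximal_independent_subset[of "S \<inter> V"] by blast
      have "span C \<subseteq> V"
        using C(1) H(2) V by (intro span_minimal) auto
      then have "p \<notin> span C" using H(2) V by auto
      \<comment> \<open>Together with \<open>p\<close> the set \<open>C\<close> stays independent
        inside \<open>span B\<close>, which gives \<open>card C < card B\<close>.\<close>
      then have "independent (insert p C)" "p \<notin> C"
        using C(2) by (auto simp: independent_insert span_base)
      moreover have "insert p C \<subseteq> span B"
        using C(1) p less.prems(2) by auto
      ultimately have "finite (insert p C) \<and> card (insert p C) \<le> card B"
        by (intro independent_span_bound[OF less.prems(1)])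
      then have fin: "finite C" "card C < card B"
        using \<open>p \<notin> C\<close> by auto
      show ?thesis
      proof (rule less.hyps[OF fin(2,1) C(3)])
        fix p' assume "p' \<in> S \<inter> V"
        then obtain H' where "finite H'" "\<forall>W\<in>H'. subspace W \<and> p' \<notin> W" "S - {p'} \<subseteq> \<Union>H'"
          using less.prems(3)[of p'] by auto
        then show "\<exists>H. finite H \<and> (\<forall>W\<in>H. subspace W \<and> p' \<notin> W) \<and> S \<inter> V - {p'} \<subseteq> \<Union>H"
          by (intro exI[of _ H']) auto
      qed
    qed
    then have "finite (insert p (\<Union>V\<in>H. S \<inter> V))" using H(1) by blast
    then show ?thesis by (rule rev_finite_subset) (use H(3) in auto)
  qed simp
qed

text \<open>Positivity of \<open>p\<close> bounds each exponent separately, by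
  \<open>c / p i\<close>.\<close>

lemma finite_monomials_bounded_weight:
  fixes p :: "nat \<Rightarrow> real"
  assumes pos: "\<And>i. i < N \<Longrightarrow> p i > 0"
  shows "finite {m :: nat \<Rightarrow>\<^sub>0 nat. Poly_Mapping.keys m \<subseteq> {..<N} \<and>
           (\<Sum>i<N. p i * real (Poly_Mapping.lookup m i)) < c}" (is "finite ?M")
proof -
  \<comment> \<open>The sum dominates every individual bound, giving one bound uniform in
    \<open>i\<close>.\<close>
  define B where "B = (\<Sum>i<N. nat \<lceil>c / p i\<rceil>)"
  have bound: "Poly_Mapping.lookup m i \<le> B" if "m \<in> ?M" "i < N" for m i
  proof -
    have "p j * real (Poly_Mapping.lookup m j) \<ge> 0" if "j < N" for j
      using pos[OF that] by simp
    then have "p i * real (Poly_Mapping.lookup m i) \<le> (\<Sum>i<N. p i * real (Poly_Mapping.lookup m i))"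
      using \<open>i < N\<close> by (intro member_le_sum) auto
    also have "\<dots> < c" using that by simp
    finally have "real (Poly_Mapping.lookup m i) \<le> c / p i"
      using pos[OF that(2)] by (simp add: field_simps)
    then have "Poly_Mapping.lookup m i \<le> nat \<lceil>c / p i\<rceil>" by linarith
    also have "\<dots> \<le> B"
      unfolding B_def using that(2) by (intro member_le_sum) auto
    finally show ?thesis .
  qed
  have "Poly_Mapping.lookup ` ?M \<subseteq>
      {f. \<forall>i. (i \<in> {..<N} \<longrightarrow> f i \<in> {..B}) \<and> (i \<notin> {..<N} \<longrightarrow> f i = 0)}"
  proof (intro image_subsetI CollectI allI conjI impI)
    fix m i assume m: "m \<in> ?M"
    show "Poly_Mapping.lookup m i \<in> {..B}" if "i \<in> {..<N}"
      using bound[OF m] that by simp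
    show "Poly_Mapping.lookup m i = 0" if "i \<notin> {..<N}"
      using m that by (auto simp: in_keys_iff)
  qed
  moreover have "finite \<dots>" by (rule finite_set_of_finite_funs) auto
  ultimately have "finite (Poly_Mapping.lookup ` ?M)" by (rule finite_subset)
  then show ?thesis
    by (rule finite_imageD) (simp add: inj_on_def poly_mapping.lookup_inject)
qed

section \<open>Normalized weights\<close>

text \<open>Extension by zero turns weight lists of a fixed length into vectors of the real space
  \<open>nat \<Rightarrow> real\<close>, where the dimension argument takes place.\<close>

definition normalized_weights :: "nat list \<Rightarrow> nat \<Rightarrow> real" where
  "normalized_weights a i = (if i < length a then real (a ! i) / real (\<Sum>j<length a. a ! j) else 0)"

lemma weight_sum_pos:
  fixes a :: "nat list"
  assumes "\<forall>i<length a. a ! i > 0" "length a > 0"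
  shows "(\<Sum>i<length a. a ! i) > 0"
  using assms by (intro sum_pos) auto

text \<open>The weights other than \<open>a ! 0\<close> already have gcd 1, so the gcd of their
  multiples by \<open>e\<close> is \<open>e\<close>.\<close>

lemma Gcd_well_formed_weights_dvd:
  assumes "well_formed_weights a" "length a > 0" "\<And>j. j < length a \<Longrightarrow> d dvd e * a ! j"
  shows "d dvd e"
proof -
  let ?A = "{a ! j | j. j < length a \<and> j \<noteq> 0}"
  have "d dvd Gcd ((*) e ` ?A)"
    using assms(3) by (auto intro!: Gcd_greatest)
  moreover have "Gcd ?A = 1"
    using assms(1,2) by (auto simp: well_formed_weights_def)
  ultimately show ?thesis by (simp add: Gcd_mult)
qed

text \<open>Equal normalized weights mean \<open>e * a ! i = d * b ! i\<close> for the totals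
  \<open>d\<close> of \<open>a\<close> and \<open>e\<close> of \<open>b\<close>. Well-formedness
  turns this into \<open>d dvd e\<close> and \<open>e dvd d\<close>, so the totals agree.\<close>

lemma normalized_weights_inj:
  assumes a: "well_formed_weights a" "\<forall>i<length a. a ! i > 0"
    and b: "well_formed_weights b" "\<forall>i<length b. b ! i > 0"
    and len: "length a = length b" "length b > 0"
    and eq: "normalized_weights a = normalized_weights b"
  shows "a = b"
proof -
  define d where "d = (\<Sum>j<length a. a ! j)"
  define e where "e = (\<Sum>j<length b. b ! j)"
  have pos: "d > 0" "e > 0"
    using weight_sum_pos[OF a(2)] weight_sum_pos[OF b(2)] len by (simp_all only: d_def e_def)
  have cross: "e * a ! i = d * b ! i" if "i < length b" for i
  proof -
    have "real (a ! i) / real d = real (b ! i) / real e"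
      using fun_cong[OF eq, of i] that len
      by (simp add: normalized_weights_def d_def e_def)
    then have "real (e * a ! i) = real (d * b ! i)"
      using pos by (simp add: field_simps)
    then show ?thesis by (simp only: of_nat_eq_iff)
  qed
  have "d dvd e"
    by (rule Gcd_well_formed_weights_dvd[OF a(1)]) (use len cross in auto)
  moreover have "e dvd d"
    by (rule Gcd_well_formed_weights_dvd[OF b(1)]) (use len cross in \<open>auto simp flip: cross\<close>)
  ultimately have "d = e" by (rule dvd_antisym)
  then show ?thesis
    using cross pos len by (intro nth_equalityI) auto
qed

lemma normalized_weights_sum:
  assumes "\<forall>i<length a. a ! i > 0" "length a > 0"
  shows "(\<Sum>i<length a. normalized_weights a i) = 1"
proof -
  have "(\<Sum>i<length a. normalized_weights a i) =
      real (\<Sum>i<length a. a ! i) / real (\<Sum>j<length a. a ! j)"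
    unfolding of_nat_sum[of _ "{..<length a}"] sum_divide_distrib
    by (intro sum.cong) (auto simp: normalized_weights_def)
  then show ?thesis
    using weight_sum_pos[OF assms] by (metis divide_self of_nat_eq_0_iff less_not_refl)
qed

lemma normalized_weights_pos:
  assumes "\<forall>i<length a. a ! i > 0" "i < length a"
  shows "normalized_weights a i > 0"
proof -
  have "length a > 0" using assms(2) by linarith
  then have "real (\<Sum>j<length a. a ! j) > 0"
    using weight_sum_pos[OF assms(1)] by (simp only: of_nat_0_less_iff)
  then show ?thesis
    unfolding normalized_weights_def using assms by (simp only: if_True) (intro divide_pos_pos, auto)
qed

section \<open>Finiteness from separating monomials\<close>

lemma vector_space_real_fun: "vector_space (\<lambda>c (f :: 'a \<Rightarrow> real) x. c * f x)"
  by unfold_locales (auto simp: fun_eq_iff algebra_simps)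

text \<open>For fixed \<open>p\<close>, each other \<open>q\<close> lies on the hyperplane of some
  monomial whose weight for \<open>p\<close> is less than 1. Only finitely many monomials are so
  light, which supplies the covering families for the dimension induction.\<close>

lemma finite_if_separated_by_monomials:
  fixes S :: "(nat \<Rightarrow> real) set"
  assumes supp: "\<And>p i. p \<in> S \<Longrightarrow> i \<ge> N \<Longrightarrow> p i = 0"
    and pos: "\<And>p i. p \<in> S \<Longrightarrow> i < N \<Longrightarrow> p i > 0"
    and sum1: "\<And>p. p \<in> S \<Longrightarrow> (\<Sum>i<N. p i) = 1"
    and sep: "\<And>p q. p \<in> S \<Longrightarrow> q \<in> S \<Longrightarrow> p \<noteq> q \<Longrightarrow>
      \<exists>m. Poly_Mapping.keys m \<subseteq> {..<N} \<and> (\<Sum>i<N. q i * real (Poly_Mapping.lookup m i)) = 1 \<and>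
          (\<Sum>i<N. p i * real (Poly_Mapping.lookup m i)) < 1"
  shows "finite S"
proof -
  interpret vector_space "\<lambda>c (f :: nat \<Rightarrow> real) x. c * f x"
    by (rule vector_space_real_fun)
  define e where "e i = (\<lambda>j. if j = i then 1 else 0 :: real)" for i :: nat
  show ?thesis
  proof (rule finite_if_covered_by_avoiding_subspaces[of "e ` {..<N}"])
    show "S \<subseteq> span (e ` {..<N})"
    proof
      fix p assume "p \<in> S"
      have sum_apply: "(\<Sum>i\<in>I. f i) x = (\<Sum>i\<in>I. f i x)" for I and f :: "nat \<Rightarrow> nat \<Rightarrow> real" and x
        by (induction I rule: infinite_finite_induct) auto
      have "p = (\<Sum>i<N. (\<lambda>x. p i * e i x))"
        using supp[OF \<open>p \<in> S\<close>] by (auto simp: fun_eq_iff sum_apply e_def if_distrib cong: if_cong)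
      also have "\<dots> \<in> span (e ` {..<N})"
        by (intro span_sum span_scale span_base) auto
      finally show "p \<in> span (e ` {..<N})" .
    qed
  next
    fix p assume p: "p \<in> S"
    \<comment> \<open>The affine condition that \<open>m\<close> has weight 1 is made linear by
      comparison with the coordinate sum, which is 1 on \<open>S\<close>.\<close>
    define V where "V m = {v. (\<Sum>i<N. v i * real (Poly_Mapping.lookup m i)) = (\<Sum>i<N. v i)}" for m
    let ?M = "{m :: nat \<Rightarrow>\<^sub>0 nat. Poly_Mapping.keys m \<subseteq> {..<N} \<and>
      (\<Sum>i<N. p i * real (Poly_Mapping.lookup m i)) < 1}"
    have "subspace (V m)" for m
      by (auto simp: subspace_def V_def distrib_right sum.distrib mult.assoc simp flip: sum_distrib_left)
    moreover have "p \<notin> V m" if "m \<in> ?M" for m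
      using that sum1[OF p] by (simp add: V_def)
    moreover have "S - {p} \<subseteq> \<Union>(V ` ?M)"
    proof
      fix q assume q: "q \<in> S - {p}"
      then obtain m where "m \<in> ?M" "(\<Sum>i<N. q i * real (Poly_Mapping.lookup m i)) = 1"
        using sep[OF p, of q] by auto
      then show "q \<in> \<Union>(V ` ?M)"
        using q sum1[of q] by (auto simp: V_def)
    qed
    moreover have "finite (V ` ?M)"
      using finite_monomials_bounded_weight[of N p] pos[OF p] by blast
    ultimately show "\<exists>H. finite H \<and> (\<forall>W\<in>H. subspace W \<and> p \<notin> W) \<and> S - {p} \<subseteq> \<Union>H"
      by (intro exI[of _ "V ` ?M"]) auto
  qed simp
qed

theorem theorem16:
  fixes n :: nat
  assumes "n \<ge> 1"
  shows "finite {a :: nat list.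
           length a = n + 1 \<and> (\<forall>i<length a. a ! i > 0) \<and> well_formed_weights a \<and>
           (\<exists>F. quasi_smooth_hypersurface a (\<Sum>i<length a. a ! i) F)}"
    (is "finite ?A")
proof (cases "n = 1")
  case True
  \<comment> \<open>Omitting either of two weights leaves a single one, which must therefore be
    1.\<close>
  have "a = [1, 1]" if "a \<in> ?A" for a
  proof -
    have len: "length a = 2" and wf: "well_formed_weights a" using that True by auto
    have "{a ! j |j. j < length a \<and> j \<noteq> 0} = {a ! 1}" "{a ! j |j. j < length a \<and> j \<noteq> 1} = {a ! 0}"
      using len by (auto simp: less_2_cases_iff)
    moreover have "Gcd {a ! j |j. j < length a \<and> j \<noteq> i} = 1" if "i < 2" for i
      using wf len that by (simp add: well_formed_weights_def)
    from this[of 0] this[of 1] have "Gcd {a ! j |j. j < length a \<and> j \<noteq> 0} = 1"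
      "Gcd {a ! j |j. j < length a \<and> j \<noteq> 1} = 1" by simp_all
    ultimately have "a ! 0 = 1" "a ! 1 = 1" by simp_all
    then show ?thesis using len
      by (intro nth_equalityI) (auto simp: less_2_cases_iff)
  qed
  then have "?A \<subseteq> {[1, 1]}" by blast
  then show ?thesis by (rule finite_subset) simp
next
  case False
  have "finite (normalized_weights ` ?A)"
  proof (rule finite_if_separated_by_monomials[of _ "n + 1"])
    fix p assume "p \<in> normalized_weights ` ?A"
    then obtain a where a: "a \<in> ?A" "p = normalized_weights a" by blast
    then show "(\<Sum>i<n + 1. p i) = 1"
      using normalized_weights_sum[of a] by auto
    show "p i = 0" if "i \<ge> n + 1" for i
      using a that by (simp add: normalized_weights_def)
    show "p i > 0" if "i < n + 1" for i
      using a that normalized_weights_pos[of a i] by simp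
    \<comment> \<open>\<open>q\<close> comes from weights \<open>b\<close> carrying a quasi-smooth
      \<open>F\<close>; the separating monomial is taken from this \<open>F\<close>, so it has
      weight 1 for \<open>q\<close> and less than 1 for \<open>p\<close>.\<close>
    fix q assume "q \<in> normalized_weights ` ?A" and ne: "p \<noteq> q"
    then obtain b where b: "b \<in> ?A" "q = normalized_weights b" by blast
    define d where "d = (\<Sum>i<length b. b ! i)"
    have d_pos: "d > 0" unfolding d_def
      using b by (intro weight_sum_pos) auto
    obtain F where F: "quasi_smooth_hypersurface b d F"
      using b by (auto simp: d_def)
    have q: "q i = real (b ! i) / real d" if "i < length b" for i
      using that b by (simp add: normalized_weights_def d_def)
    have len: "length b = n + 1" using b by simp
    obtain i where i: "p i \<noteq> q i" using ne by (auto simp: fun_eq_iff)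
    have "i < length b"
      using i a b by (cases "i < n + 1") (auto simp: normalized_weights_def)
    then have "\<exists>i<length b. p i \<noteq> real (b ! i) / real d" using i q by auto
    \<comment> \<open>\<open>n \<ge> 1\<close> and \<open>n \<noteq> 1\<close> provide the three
      weights that the separation asks for.\<close>
    then obtain m where m: "m \<in> Poly_Mapping.keys F"
      "(\<Sum>i<length b. p i * real (Poly_Mapping.lookup m i)) < 1"
      using quasi_smooth_separating_monomial[OF F _ _ d_def] b False assms
        \<open>(\<Sum>i<n + 1. p i) = 1\<close> len by auto
    have keys: "Poly_Mapping.keys m \<subseteq> {..<n + 1}"
      and deg: "(\<Sum>i<n + 1. b ! i * Poly_Mapping.lookup m i) = d"
      using F m(1) len by (auto simp: quasi_smooth_hypersurface_def weighted_homogeneous_def)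
    have "(\<Sum>i<n + 1. q i * real (Poly_Mapping.lookup m i)) =
        real (\<Sum>i<n + 1. b ! i * Poly_Mapping.lookup m i) / real d"
      unfolding of_nat_sum sum_divide_distrib using q len by (intro sum.cong) auto
    then have "(\<Sum>i<n + 1. q i * real (Poly_Mapping.lookup m i)) = 1"
      using deg d_pos by (simp only: divide_self_if of_nat_eq_0_iff) simp
    then show "\<exists>m. Poly_Mapping.keys m \<subseteq> {..<n + 1} \<and>
        (\<Sum>i<n + 1. q i * real (Poly_Mapping.lookup m i)) = 1 \<and>
        (\<Sum>i<n + 1. p i * real (Poly_Mapping.lookup m i)) < 1"
      using keys m(2) len by (intro exI[of _ m]) simp
  qed
  moreover have "inj_on normalized_weights ?A"
    by (intro inj_onI normalized_weights_inj) auto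
  ultimately show ?thesis by (rule finite_imageD)
qed

end
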